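(* Let $x\in(-1,1)$ and $n,k\in\mathbb N_0$ with $(n,k)\ne(0,0)$. Then $${\sf Q}_{k+n-\frac12}^{n-\frac12}(x)=\frac{\pi(-1)^{n+k}(2n+k-1)!}{2^{k+n+\frac12}\,k!\,\Gamma(k+n+\frac12)\,(1-x^2)^{\frac n2-\frac14}}\left(\frac{\mathrm d}{\mathrm dx}\right)^k\left[(1-x^2)^{k+n-\frac12}\right].$$
   Context: $\mathbb N_0=\{0,1,2,\ldots\}$. For $x\in(-1,1)$ the Ferrers function of the first kind is $${\sf P}_\nu^{-\mu}(x)=\left(\frac{1-x}{1+x}\right)^{\frac{\mu}{2}}\sum_{j=0}^\infty\frac{(-\nu)_j(\nu+1)_j}{\Gamma(\mu+1+j)\,j!}\left(\frac{1-x}{2}\right)^j ,$$ with $(a)_0=1$, $(a)_j=a(a+1)\cdots(a+j-1)$ and $1/\Gamma$ the entire reciprocal gamma function, i.e. ${\sf P}_\nu^{-\mu}(x)=\frac{1}{\Gamma(\mu+1)}\left(\frac{1-x}{1+x}\right)^{\mu/2}{}_2F_1\left(-\nu,\nu+1;\mu+1;\frac{1-x}{2}\right)$. The Ferrers function of the second kind is, for $\mu\notin\mathbb Z$, $${\sf Q}_\nu^\mu(x)=\frac{\pi}{2\sin(\pi\mu)}\left(\cos(\pi\mu)\,{\sf P}_\nu^{\mu}(x)-\frac{\Gamma(\nu+\mu+1)}{\Gamma(\nu-\mu+1)}\,{\sf P}_\nu^{-\mu}(x)\right).$$ *)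

theory Defs
  imports "HOL-Analysis.Analysis"
begin

(* ferrers_P \<nu> \<mu> x is P_\<nu>^\<mu>(x), so the series that is usually displayed for P_\<nu>^{-\<mu>}
   appears here with \<mu> replaced by -\<mu>.  Degree and order are complex, and both functions
   are meant for -1 < x < 1 only, where the base of powr is a positive real and the
   series converges. *)
definition ferrers_P :: "complex \<Rightarrow> complex \<Rightarrow> real \<Rightarrow> complex" where
  "ferrers_P \<nu> \<mu> x =
     complex_of_real ((1 - x) / (1 + x)) powr (- \<mu> / 2) *
     (\<Sum>j. pochhammer (- \<nu>) j * pochhammer (\<nu> + 1) j * rGamma (- \<mu> + 1 + of_nat j) / fact j *
          complex_of_real ((1 - x) / 2) ^ j)"

(* Meaningful for \<mu> not an integer and \<nu> + \<mu> + 1 not a pole of Gamma.  At a pole of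
   Gamma (\<nu> - \<mu> + 1) the quotient is 0, as it should be, because Gamma is 0 at its poles
   and division by 0 gives 0. *)
definition ferrers_Q :: "complex \<Rightarrow> complex \<Rightarrow> real \<Rightarrow> complex" where
  "ferrers_Q \<nu> \<mu> x =
     of_real pi / (2 * sin (of_real pi * \<mu>)) *
     (cos (of_real pi * \<mu>) * ferrers_P \<nu> \<mu> x
      - Gamma (\<nu> + \<mu> + 1) / Gamma (\<nu> - \<mu> + 1) * ferrers_P \<nu> (- \<mu>) x)"

end

theory Submission
  imports Defs
begin

text \<open>
  At the half-integer order \<open>\<mu> = n - 1/2\<close> the cosine in the definition of the Ferrers function
  of the second kind vanishes, so with \<open>\<nu> = \<mu> + k\<close> only a multiple of \<open>P\<^sub>\<nu>\<^sup>-\<^sup>\<mu>\<close> survives.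
  It therefore suffices to prove, for real \<open>\<mu> > -1\<close>, the Rodrigues formula
  \<open>P\<^sub>\<nu>\<^sup>-\<^sup>\<mu>(x) = (-1)\<^sup>k (1 - x\<^sup>2)\<^sup>-\<^sup>\<mu>\<^sup>/\<^sup>2 / (2\<^sup>\<nu> \<Gamma>(\<nu> + 1)) (d/dx)\<^sup>k (1 - x\<^sup>2)\<^sup>\<nu>\<close>,
  which is the lemma \<open>ferrers_P_Rodrigues\<close>.

  In the variable \<open>z = (1 - x)/2\<close> one has \<open>1 - x\<^sup>2 = 4z(1 - z)\<close>, and the binomial series gives
  \<open>z\<^sup>\<nu> (1 - z)\<^sup>\<nu> = \<Sum>\<^sub>j (-\<nu>)\<^sub>j / j! z\<^sup>\<nu>\<^sup>+\<^sup>j\<close>. Differentiating \<open>k\<close> times term by term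
  (\<open>higher_deriv_powr_power_series\<close>) multiplies the \<open>j\<close>-th term by
  \<open>(\<mu> + j + 1)\<^sub>k = \<Gamma>(\<nu> + 1) (\<nu> + 1)\<^sub>j / \<Gamma>(\<mu> + j + 1)\<close> and lowers its exponent to \<open>\<mu> + j\<close>.
  This is exactly the series that defines \<open>P\<^sub>\<nu>\<^sup>-\<^sup>\<mu>\<close>, so no transformation of hypergeometric
  functions is needed.
\<close>

lemma power_series_Euler_operator:
  fixes c :: "nat \<Rightarrow> real" and q z :: real
  assumes c: "\<And>z. \<bar>z\<bar> < 1 \<Longrightarrow> summable (\<lambda>j. c j * z ^ j)" and z: "\<bar>z\<bar> < 1"
  shows "(\<lambda>j. (q + real j) * c j * z ^ j) sums
           (q * (\<Sum>j. c j * z ^ j) + z * (\<Sum>j. diffs c j * z ^ j))"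
proof -
  have "summable (\<lambda>j. diffs c j * z ^ j)"
    using termdiff_converges[of z 1 c] c z by simp
  from sums_mult[OF diffs_equiv[OF this], of z]
  have "(\<lambda>j. z * (real j * c j * z ^ (j - Suc 0))) sums (z * (\<Sum>j. diffs c j * z ^ j))"
    by simp
  moreover have "z * (real j * c j * z ^ (j - Suc 0)) = real j * c j * z ^ j" for j
    by (cases j) auto
  ultimately have "(\<lambda>j. real j * c j * z ^ j) sums (z * (\<Sum>j. diffs c j * z ^ j))"
    by simp
  from sums_add[OF sums_mult[OF summable_sums[OF c[OF z]], of q] this]
  show ?thesis by (simp add: algebra_simps)
qed

lemma has_field_derivative_powr_power_series:
  fixes c :: "nat \<Rightarrow> real" and q x :: real
  assumes c: "\<And>z. \<bar>z\<bar> < 1 \<Longrightarrow> summable (\<lambda>j. c j * z ^ j)" and x: "x \<in> {-1<..<1}"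
  shows "((\<lambda>t. ((1 - t) / 2) powr q * (\<Sum>j. c j * ((1 - t) / 2) ^ j)) has_field_derivative
           (-1/2) * ((1 - x) / 2) powr (q - 1) *
             (\<Sum>j. (q + real j) * c j * ((1 - x) / 2) ^ j)) (at x)"
proof -
  define z where "z = (1 - x) / 2"
  have z: "z > 0" "\<bar>z\<bar> < 1" using x by (auto simp: z_def)
  have lin: "((\<lambda>t. (1 - t) / 2) has_field_derivative -1/2) (at x)"
    by (auto intro!: derivative_eq_intros)
  have ser: "((\<lambda>z. \<Sum>j. c j * z ^ j) has_field_derivative (\<Sum>j. diffs c j * z ^ j)) (at z)"
    using termdiffs_strong'[of 1 c z] c z by simp
  have pow: "((\<lambda>z. z powr q) has_field_derivative q * z powr (q - 1)) (at z)"
    using has_real_derivative_powr[of z q] z by simp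
  have euler: "(\<Sum>j. (q + real j) * c j * z ^ j) =
                 q * (\<Sum>j. c j * z ^ j) + z * (\<Sum>j. diffs c j * z ^ j)"
    by (rule sums_unique[symmetric], rule power_series_Euler_operator[OF c z(2)])
  have "((\<lambda>z. z powr q * (\<Sum>j. c j * z ^ j)) has_field_derivative
          q * z powr (q - 1) * (\<Sum>j. c j * z ^ j) + (\<Sum>j. diffs c j * z ^ j) * z powr q) (at z)"
    by (rule DERIV_mult[OF pow ser])
  also have "z powr q = z powr (q - 1) * z"
    using z powr_add[of z "q - 1" 1] by simp
  also have "q * z powr (q - 1) * (\<Sum>j. c j * z ^ j) +
               (\<Sum>j. diffs c j * z ^ j) * (z powr (q - 1) * z) =
             z powr (q - 1) * (\<Sum>j. (q + real j) * c j * z ^ j)"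
    unfolding euler by (simp add: distrib_left mult_ac)
  finally have "((\<lambda>z. z powr q * (\<Sum>j. c j * z ^ j)) has_field_derivative
      z powr (q - 1) * (\<Sum>j. (q + real j) * c j * z ^ j)) (at ((1 - x) / 2))"
    by (simp add: z_def)
  from DERIV_chain2[OF this lin] show ?thesis
    by (simp add: z_def mult_ac)
qed

lemma summable_pochhammer_power_series:
  fixes a :: "nat \<Rightarrow> real" and p z :: real
  assumes a: "\<And>z. \<bar>z\<bar> < 1 \<Longrightarrow> summable (\<lambda>j. a j * z ^ j)" and z: "\<bar>z\<bar> < 1"
  shows "summable (\<lambda>j. pochhammer (p + real j - real k + 1) k * a j * z ^ j)"
  using z
proof (induction k arbitrary: z)
  case 0
  then show ?case using a by simp
next
  case (Suc k)
  show ?case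
    using sums_summable[OF power_series_Euler_operator[OF Suc.IH Suc.prems, of "p - real k"]]
    by (simp add: pochhammer_rec algebra_simps)
qed

text \<open>
  The factor \<open>(-1/2)\<^sup>k\<close> comes from the substitution \<open>z = (1 - x)/2\<close>; the Pochhammer symbol
  \<open>(p + j - k + 1)\<^sub>k\<close> is the falling product \<open>(p + j) (p + j - 1) \<cdots> (p + j - k + 1)\<close>.
\<close>

lemma higher_deriv_powr_power_series:
  fixes a :: "nat \<Rightarrow> real" and p :: real
  assumes a: "\<And>z. \<bar>z\<bar> < 1 \<Longrightarrow> summable (\<lambda>j. a j * z ^ j)"
    and f: "\<And>t. t \<in> {-1<..<1} \<Longrightarrow> f t = ((1 - t) / 2) powr p * (\<Sum>j. a j * ((1 - t) / 2) ^ j)"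
    and x: "x \<in> {-1<..<1}"
  shows "(deriv ^^ k) f x = (-1/2) ^ k * ((1 - x) / 2) powr (p - real k) *
           (\<Sum>j. pochhammer (p + real j - real k + 1) k * a j * ((1 - x) / 2) ^ j)"
proof -
  define c where "c = (\<lambda>k j. pochhammer (p + real j - real k + 1) k * a j)"
  have c_Suc: "c (Suc k) j = (p - real k + real j) * c k j" for k j
    by (simp add: c_def pochhammer_rec algebra_simps)
  have summ: "summable (\<lambda>j. c k j * z ^ j)" if "\<bar>z\<bar> < 1" for k z
    unfolding c_def using a that by (rule summable_pochhammer_power_series)
  have "(deriv ^^ k) f x =
          (-1/2) ^ k * ((1 - x) / 2) powr (p - real k) * (\<Sum>j. c k j * ((1 - x) / 2) ^ j)"
    using x
  proof (induction k arbitrary: x)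
    case 0
    then show ?case using f by (simp add: c_def)
  next
    case (Suc k)
    have "(deriv ^^ Suc k) f x = deriv (\<lambda>t. (-1/2) ^ k *
            (((1 - t) / 2) powr (p - real k) * (\<Sum>j. c k j * ((1 - t) / 2) ^ j))) x"
      unfolding funpow.simps o_def
    proof (rule deriv_cong_ev)
      show "\<forall>\<^sub>F t in nhds x. (deriv ^^ k) f t = (-1/2) ^ k *
              (((1 - t) / 2) powr (p - real k) * (\<Sum>j. c k j * ((1 - t) / 2) ^ j))"
        by (rule eventually_mono[OF eventually_nhds_in_open[OF open_greaterThanLessThan Suc.prems]])
          (use Suc.IH in simp)
    qed simp
    also have "\<dots> = (-1/2) ^ k * ((-1/2) * ((1 - x) / 2) powr (p - real k - 1) *
                 (\<Sum>j. (p - real k + real j) * c k j * ((1 - x) / 2) ^ j))"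
      by (intro DERIV_imp_deriv DERIV_cmult has_field_derivative_powr_power_series summ Suc.prems)
    finally show ?case by (simp add: c_Suc algebra_simps)
  qed
  then show ?thesis by (simp add: c_def)
qed

lemma binomial_series_pochhammer:
  fixes \<nu> z :: real
  assumes "\<bar>z\<bar> < 1"
  shows "(\<lambda>j. pochhammer (- \<nu>) j / fact j * z ^ j) sums (1 - z) powr \<nu>"
proof -
  have "(\<nu> gchoose j) * (- z) ^ j = pochhammer (- \<nu>) j / fact j * z ^ j" for j
    by (simp add: gbinomial_pochhammer power_minus[of z] flip: power_add mult_2)
  with gen_binomial_real[of "- z" \<nu>] assms show ?thesis by simp
qed

lemma pochhammer_shift_Gamma:
  fixes \<mu> :: real
  assumes "\<mu> > -1"
  shows "pochhammer (\<mu> + real j + 1) k =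
           Gamma (\<mu> + real k + 1) * pochhammer (\<mu> + real k + 1) j * rGamma (\<mu> + 1 + real j)"
proof -
  have pos: "\<mu> + real j + 1 \<notin> \<int>\<^sub>\<le>\<^sub>0" "\<mu> + real k + 1 \<notin> \<int>\<^sub>\<le>\<^sub>0"
    using assms by (auto elim!: nonpos_Ints_cases')
  have "Gamma (\<mu> + real k + 1) \<noteq> 0"
    using pos by (simp add: Gamma_eq_zero_iff)
  with pos show ?thesis
    by (simp add: pochhammer_Gamma rGamma_inverse_Gamma divide_simps add_ac)
qed

lemma ferrers_P_Rodrigues:
  fixes \<mu> x :: real and k :: nat
  assumes \<mu>: "\<mu> > -1" and x: "x \<in> {-1<..<1}"
  shows "ferrers_P (complex_of_real (\<mu> + real k)) (- complex_of_real \<mu>) x =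
           complex_of_real ((-1) ^ k / (2 powr (\<mu> + real k) * Gamma (\<mu> + real k + 1) *
             (1 - x\<^sup>2) powr (\<mu> / 2)) *
             (deriv ^^ k) (\<lambda>t. (1 - t\<^sup>2) powr (\<mu> + real k)) x)"
proof -
  define \<nu> where "\<nu> = \<mu> + real k"
  define z where "z = (1 - x) / 2"
  define S where
    "S = (\<Sum>j. pochhammer (- \<nu>) j * pochhammer (\<nu> + 1) j * rGamma (\<mu> + 1 + real j) / fact j * z ^ j)"
  define a where "a = (\<lambda>j. 4 powr \<nu> * (pochhammer (- \<nu>) j / fact j))"
  have z: "0 < z" "z < 1" using x by (auto simp: z_def)
  have a_sums: "(\<lambda>j. a j * y ^ j) sums (4 powr \<nu> * (1 - y) powr \<nu>)" if "\<bar>y\<bar> < 1" for y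
    using sums_mult[OF binomial_series_pochhammer[OF that, of \<nu>], of "4 powr \<nu>"]
    by (simp add: a_def mult_ac)
  have f: "(1 - t\<^sup>2) powr \<nu> = ((1 - t) / 2) powr \<nu> * (\<Sum>j. a j * ((1 - t) / 2) ^ j)"
    if t: "t \<in> {-1<..<1}" for t
  proof -
    have "1 - t\<^sup>2 = ((1 - t) / 2) * (4 * (1 - (1 - t) / 2))"
      by (simp add: power2_eq_square field_simps)
    then have "(1 - t\<^sup>2) powr \<nu> = ((1 - t) / 2) powr \<nu> * (4 powr \<nu> * (1 - (1 - t) / 2) powr \<nu>)"
      using t by (simp only: powr_mult)
    also have "4 powr \<nu> * (1 - (1 - t) / 2) powr \<nu> = (\<Sum>j. a j * ((1 - t) / 2) ^ j)"
      using t by (intro sums_unique a_sums) (auto simp: abs_if)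
    finally show ?thesis .
  qed
  have term_eq: "pochhammer (\<nu> + real j - real k + 1) k * a j * z ^ j =
      (4 powr \<nu> * Gamma (\<nu> + 1)) *
      (pochhammer (- \<nu>) j * pochhammer (\<nu> + 1) j * rGamma (\<mu> + 1 + real j) / fact j * z ^ j)" for j
    using pochhammer_shift_Gamma[OF \<mu>, of j k] by (simp add: a_def \<nu>_def)
  have Gpos: "Gamma (\<nu> + 1) > 0"
    using \<mu> by (intro Gamma_real_pos) (simp add: \<nu>_def)
  have poch_summ: "summable (\<lambda>j. pochhammer (\<nu> + real j - real k + 1) k * a j * z ^ j)"
    using z by (intro summable_pochhammer_power_series sums_summable[OF a_sums]) auto
  have S_summ: "summable (\<lambda>j. pochhammer (- \<nu>) j * pochhammer (\<nu> + 1) j *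
                   rGamma (\<mu> + 1 + real j) / fact j * z ^ j)"
    using poch_summ Gpos unfolding term_eq summable_cmult_iff by simp
  have "(deriv ^^ k) (\<lambda>t. (1 - t\<^sup>2) powr \<nu>) x = (-1/2) ^ k * z powr (\<nu> - real k) *
          (\<Sum>j. pochhammer (\<nu> + real j - real k + 1) k * a j * z ^ j)"
    unfolding z_def by (rule higher_deriv_powr_power_series[OF sums_summable[OF a_sums] f x])
  also have "\<dots> = (-1/2) ^ k * z powr \<mu> * (4 powr \<nu> * Gamma (\<nu> + 1) * S)"
    unfolding term_eq S_def by (subst suminf_mult[OF S_summ]) (simp add: \<nu>_def)
  finally have D: "(deriv ^^ k) (\<lambda>t. (1 - t\<^sup>2) powr \<nu>) x =
                     (-1/2) ^ k * z powr \<mu> * (4 powr \<nu> * Gamma (\<nu> + 1) * S)" .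

  have "(\<Sum>j. pochhammer (- complex_of_real \<nu>) j * pochhammer (complex_of_real \<nu> + 1) j *
          rGamma (complex_of_real \<mu> + 1 + of_nat j) / fact j * complex_of_real z ^ j) =
        complex_of_real S"
  proof -
    have "pochhammer (- complex_of_real \<nu>) j * pochhammer (complex_of_real \<nu> + 1) j *
          rGamma (complex_of_real \<mu> + 1 + of_nat j) / fact j * complex_of_real z ^ j =
        complex_of_real (pochhammer (- \<nu>) j * pochhammer (\<nu> + 1) j *
          rGamma (\<mu> + 1 + real j) / fact j * z ^ j)" for j
      by (simp flip: pochhammer_of_real rGamma_complex_of_real)
    then show ?thesis
      unfolding S_def by (simp only: suminf_of_real[OF S_summ])
  qed
  then have "ferrers_P (complex_of_real \<nu>) (- complex_of_real \<mu>) x =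
      complex_of_real (((1 - x) / (1 + x)) powr (\<mu> / 2) * S)"
    using x powr_of_real[of "(1 - x) / (1 + x)" "\<mu> / 2"]
    by (simp add: ferrers_P_def flip: z_def)
  also have "((1 - x) / (1 + x)) powr (\<mu> / 2) * S =
      (-1) ^ k / (2 powr \<nu> * Gamma (\<nu> + 1) * (1 - x\<^sup>2) powr (\<mu> / 2)) *
        (deriv ^^ k) (\<lambda>t. (1 - t\<^sup>2) powr \<nu>) x"
  proof -
    have "(1 - x\<^sup>2) = (1 - x) * (1 + x)"
      by (simp add: power2_eq_square algebra_simps)
    then have powr_prod: "(1 - x\<^sup>2) powr (\<mu> / 2) = (1 - x) powr (\<mu> / 2) * (1 + x) powr (\<mu> / 2)"
      using x by (simp add: powr_mult)
    have "(1 - x) powr \<mu> = (1 - x) powr (\<mu> / 2) * (1 - x) powr (\<mu> / 2)"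
      by (simp flip: powr_add)
    then have zmu: "z powr \<mu> = (1 - x) powr (\<mu> / 2) * (1 - x) powr (\<mu> / 2) / 2 powr \<mu>"
      using x by (simp add: z_def powr_divide)
    have "(4::real) powr \<nu> = 2 powr \<nu> * 2 powr \<nu>"
      by (simp flip: powr_mult)
    then have four: "(4::real) powr \<nu> = 2 powr \<nu> * (2 powr \<mu> * 2 ^ k)"
      by (simp add: \<nu>_def powr_add powr_realpow)
    have sgn: "(-1::real) ^ k * (-1/2) ^ k = 1 / 2 ^ k"
      by (simp flip: power_mult_distrib add: power_one_over)
    have "(-1) ^ k / (2 powr \<nu> * Gamma (\<nu> + 1) * (1 - x\<^sup>2) powr (\<mu> / 2)) *
        (deriv ^^ k) (\<lambda>t. (1 - t\<^sup>2) powr \<nu>) x =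
        ((-1) ^ k * (-1/2) ^ k) * 2 ^ k * (z powr \<mu> * 2 powr \<mu>) * S / (1 - x\<^sup>2) powr (\<mu> / 2)"
      unfolding D four using Gpos by simp
    also have "\<dots> = ((1 - x) powr (\<mu> / 2) * (1 - x) powr (\<mu> / 2)) * S / (1 - x\<^sup>2) powr (\<mu> / 2)"
      unfolding sgn zmu by simp
    also have "\<dots> = ((1 - x) / (1 + x)) powr (\<mu> / 2) * S"
      using x unfolding powr_prod by (simp add: powr_divide)
    finally show ?thesis by simp
  qed
  finally show ?thesis by (simp add: \<nu>_def)
qed

theorem corollary1p10:
  fixes x :: real and n k :: nat
  assumes "x \<in> {-1<..<1}" and "(n, k) \<noteq> (0, 0)"
  shows "ferrers_Q (of_nat k + of_nat n - 1 / 2) (of_nat n - 1 / 2) x =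
    complex_of_real
      (pi * (-1) ^ (n + k) * fact (2 * n + k - 1) /
         (2 powr (real k + real n + 1 / 2) * fact k * Gamma (real k + real n + 1 / 2) *
          (1 - x\<^sup>2) powr (real n / 2 - 1 / 4)) *
       (deriv ^^ k) (\<lambda>t::real. (1 - t\<^sup>2) powr (real k + real n - 1 / 2)) x)"
proof -
  define \<mu> where "\<mu> = real n - 1 / 2"
  define D where "D = (deriv ^^ k) (\<lambda>t::real. (1 - t\<^sup>2) powr (\<mu> + real k)) x"
  have nu: "of_nat k + of_nat n - 1 / 2 = complex_of_real (\<mu> + real k)"
    and mu: "of_nat n - 1 / 2 = complex_of_real \<mu>"
    by (simp_all add: \<mu>_def)
  have "sin (pi * \<mu>) = - ((-1) ^ n)" and "cos (pi * \<mu>) = 0"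
    by (simp_all add: \<mu>_def right_diff_distrib sin_diff cos_diff mult.commute[of pi])
  then have trig: "sin (of_real pi * complex_of_real \<mu>) = - ((-1) ^ n)"
      "cos (of_real pi * complex_of_real \<mu>) = 0"
    by (simp_all add: sin_of_real cos_of_real flip: of_real_mult)
  \<comment> \<open>Since \<open>(n, k) \<noteq> (0, 0)\<close>, the subtraction does not truncate and \<open>\<nu> + \<mu> + 1\<close> is not a pole.\<close>
  have "2 * n + k = 1 + (2 * n + k - 1)"
    using assms(2) by auto
  then have "of_nat (2 * n + k) = (1 + of_nat (2 * n + k - 1) :: complex)"
    by (metis of_nat_1 of_nat_add)
  then have "complex_of_real (\<mu> + real k) + complex_of_real \<mu> + 1 = 1 + of_nat (2 * n + k - 1)"
    by (simp add: \<mu>_def)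
  then have G1: "Gamma (complex_of_real (\<mu> + real k) + complex_of_real \<mu> + 1) = fact (2 * n + k - 1)"
    by (simp only: Gamma_fact)
  have "complex_of_real (\<mu> + real k) - complex_of_real \<mu> + 1 = 1 + of_nat k"
    by simp
  then have G2: "Gamma (complex_of_real (\<mu> + real k) - complex_of_real \<mu> + 1) = fact k"
    by (simp only: Gamma_fact)
  have "ferrers_Q (of_nat k + of_nat n - 1 / 2) (of_nat n - 1 / 2) x =
      complex_of_real (pi / 2 * (-1) ^ n * (fact (2 * n + k - 1) / fact k)) *
      ferrers_P (complex_of_real (\<mu> + real k)) (- complex_of_real \<mu>) x"
    unfolding nu mu ferrers_Q_def trig G1 G2
    by (cases "even n") simp_all
  also have "\<dots> = complex_of_real (pi / 2 * (-1) ^ n * (fact (2 * n + k - 1) / fact k) *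
      ((-1) ^ k / (2 powr (\<mu> + real k) * Gamma (\<mu> + real k + 1) * (1 - x\<^sup>2) powr (\<mu> / 2)) * D))"
    unfolding D_def using assms(1)
    by (subst ferrers_P_Rodrigues) (auto simp: \<mu>_def)
  also have "pi / 2 * (-1) ^ n * (fact (2 * n + k - 1) / fact k) *
      ((-1) ^ k / (2 powr (\<mu> + real k) * Gamma (\<mu> + real k + 1) * (1 - x\<^sup>2) powr (\<mu> / 2)) * D) =
      pi * (-1) ^ (n + k) * fact (2 * n + k - 1) /
         (2 powr (\<mu> + real k + 1) * fact k * Gamma (\<mu> + real k + 1) * (1 - x\<^sup>2) powr (\<mu> / 2)) * D"
    by (simp add: powr_add power_add mult_ac)
  also have "\<mu> + real k + 1 = real k + real n + 1 / 2"
    by (simp add: \<mu>_def)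
  also have "\<mu> / 2 = real n / 2 - 1 / 4"
    by (simp add: \<mu>_def)
  also have "D = (deriv ^^ k) (\<lambda>t::real. (1 - t\<^sup>2) powr (real k + real n - 1 / 2)) x"
    by (simp add: D_def \<mu>_def algebra_simps)
  finally show ?thesis .
qed

end
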